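(* Let $G$ be a finite-dimensional (real) Lie group (not necessarily connected). Then the space of primitive differential 2-forms on $G$ vanishes: if $\eta$ is a 2-form on $G$ with $m^*\eta = \mathrm{pr}_1^*\eta + \mathrm{pr}_2^*\eta$ on $G\times G$, then $\eta = 0$.
   Context: Differential forms are smooth and real-valued. $m\colon G\times G\to G$ is the multiplication map and $\mathrm{pr}_i\colon G\times G\to G$ is projection onto the $i$-th factor. A differential form $\eta$ on $G$ is called primitive if $m^*\eta = \mathrm{pr}_1^*\eta+\mathrm{pr}_2^*\eta$. *)

theory Defs
  imports "HOL-Analysis.Analysis" "HOL-Algebra.Group"
begin

section \<open>Smooth functions on open subsets of finite-dimensional spaces\<close>

text \<open>
  For an open set \<open>S\<close> in a finite-dimensional space, \<open>f\<close> is of class \<open>C\<^sup>k\<close> on \<open>S\<close> iff all its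
  iterated directional derivatives up to order \<open>k\<close> exist (as values of total derivatives) and are
  continuous.
\<close>

primrec Ck_on :: "nat \<Rightarrow> 'e::real_normed_vector set \<Rightarrow> ('e \<Rightarrow> 'f::real_normed_vector) \<Rightarrow> bool" where
  "Ck_on 0 S f \<longleftrightarrow> continuous_on S f"
| "Ck_on (Suc k) S f \<longleftrightarrow>
     (\<forall>x\<in>S. f differentiable (at x)) \<and>
     (\<forall>v. Ck_on k S (\<lambda>x. frechet_derivative f (at x) v))"

definition smooth_on :: "'e::real_normed_vector set \<Rightarrow> ('e \<Rightarrow> 'f::real_normed_vector) \<Rightarrow> bool" where
  "smooth_on S f \<longleftrightarrow> (\<forall>k. Ck_on k S f)"


section \<open>Smooth manifolds\<close>

text \<open>
  A chart \<open>(U, \<phi>)\<close> is given by its domain and its coordinate map; the values of \<open>\<phi>\<close> outside \<open>U\<close>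
  are irrelevant.
\<close>

type_synonym ('a, 'e) chart = "'a set \<times> ('a \<Rightarrow> 'e)"

record ('a, 'e) manifold =
  mtop :: "'a topology"
  atlas :: "('a, 'e) chart set"

definition is_chart :: "'a topology \<Rightarrow> ('a, 'e::real_normed_vector) chart \<Rightarrow> bool" where
  "is_chart X c \<longleftrightarrow> (case c of (U, \<phi>) \<Rightarrow>
     openin X U \<and> open (\<phi> ` U) \<and>
     homeomorphic_map (subtopology X U) (top_of_set (\<phi> ` U)) \<phi>)"

text \<open>The expression \<open>\<psi> \<circ> f \<circ> \<phi>\<^sup>-\<^sup>1\<close> of a map in local coordinates.\<close>

definition loc_rep ::
  "('a, 'e) chart \<Rightarrow> ('a \<Rightarrow> 'b) \<Rightarrow> ('b, 'f) chart \<Rightarrow> 'e \<Rightarrow> 'f" where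
  "loc_rep c f d = snd d \<circ> f \<circ> inv_into (fst c) (snd c)"

text \<open>
  The model space is a type of class \<open>real_normed_vector\<close> that is assumed to be
  finite-dimensional. Unlike \<open>euclidean_space\<close>, this does not exclude dimension \<open>0\<close>.
\<close>

locale smooth_manifold =
  fixes M :: "('a, 'e::real_normed_vector) manifold"
  assumes finite_dim: "\<exists>B::'e set. finite B \<and> span B = UNIV"
    and Hausdorff: "Hausdorff_space (mtop M)"
    and second_countable: "second_countable (mtop M)"
    and charts: "c \<in> atlas M \<Longrightarrow> is_chart (mtop M) c"
    and covering: "(\<Union>c\<in>atlas M. fst c) = topspace (mtop M)"
    and compatible: "c \<in> atlas M \<Longrightarrow> d \<in> atlas M \<Longrightarrow>
      smooth_on (snd c ` (fst c \<inter> fst d)) (loc_rep c id d)"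

definition smooth_map ::
  "('a, 'e::real_normed_vector) manifold \<Rightarrow> ('b, 'f::real_normed_vector) manifold \<Rightarrow> ('a \<Rightarrow> 'b) \<Rightarrow> bool"
where
  "smooth_map M N f \<longleftrightarrow> continuous_map (mtop M) (mtop N) f \<and>
     (\<forall>c\<in>atlas M. \<forall>d\<in>atlas N. smooth_on (snd c ` (fst c \<inter> f -` fst d)) (loc_rep c f d))"

definition prod_manifold ::
  "('a, 'e) manifold \<Rightarrow> ('b, 'f) manifold \<Rightarrow> ('a \<times> 'b, 'e \<times> 'f) manifold" where
  "prod_manifold M N =
     \<lparr>mtop = prod_topology (mtop M) (mtop N),
      atlas = {(U \<times> V, map_prod \<phi> \<psi>) | U \<phi> V \<psi>. (U, \<phi>) \<in> atlas M \<and> (V, \<psi>) \<in> atlas N}\<rparr>"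


section \<open>Tangent vectors and differentials\<close>

definition charts_at :: "('a, 'e) manifold \<Rightarrow> 'a \<Rightarrow> ('a, 'e) chart set" where
  "charts_at M p = {c \<in> atlas M. p \<in> fst c}"

text \<open>
  A tangent vector at \<open>p\<close> is an equivalence class of pairs \<open>(c, u)\<close> of a chart \<open>c\<close> around \<open>p\<close> and a
  coordinate vector \<open>u\<close>, where \<open>(c, u) \<sim> (d, w)\<close> iff the derivative of the transition map at \<open>p\<close>
  takes \<open>u\<close> to \<open>w\<close>. Such a class contains exactly one pair for each chart \<open>c\<close> around \<open>p\<close>, so it is
  encoded as the function sending \<open>c\<close> to its coordinate vector (and other charts to \<open>0\<close>). The
  vector space operations are pointwise.
\<close>

type_synonym ('a, 'e) tvec = "('a, 'e) chart \<Rightarrow> 'e"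

definition tangent_space ::
  "('a, 'e::real_normed_vector) manifold \<Rightarrow> 'a \<Rightarrow> ('a, 'e) tvec set" where
  "tangent_space M p =
     {v. (\<forall>c\<in>charts_at M p. \<forall>d\<in>charts_at M p.
            v d = frechet_derivative (loc_rep c id d) (at (snd c p)) (v c)) \<and>
         (\<forall>c. c \<notin> charts_at M p \<longrightarrow> v c = 0)}"

text \<open>The tangent vector at \<open>p\<close> whose coordinates in the chart \<open>c\<close> are \<open>u\<close>.\<close>

definition coord_vec ::
  "('a, 'e::real_normed_vector) manifold \<Rightarrow> 'a \<Rightarrow> ('a, 'e) chart \<Rightarrow> 'e \<Rightarrow> ('a, 'e) tvec" where
  "coord_vec M p c u = (\<lambda>d. if d \<in> charts_at M p
     then frechet_derivative (loc_rep c id d) (at (snd c p)) u else 0)"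

text \<open>
  For smooth \<open>f\<close> and \<open>v\<close> in the tangent space at \<open>p\<close>, the value does not depend on the choice of
  the chart \<open>c\<close>.
\<close>

definition differential ::
  "('a, 'e::real_normed_vector) manifold \<Rightarrow> ('b, 'f::real_normed_vector) manifold \<Rightarrow> ('a \<Rightarrow> 'b)
     \<Rightarrow> 'a \<Rightarrow> ('a, 'e) tvec \<Rightarrow> ('b, 'f) tvec" where
  "differential M N f p v = (\<lambda>d. if d \<in> charts_at N (f p)
     then (let c = (SOME c. c \<in> charts_at M p)
           in frechet_derivative (loc_rep c f d) (at (snd c p)) (v c))
     else 0)"


section \<open>Differential forms\<close>

text \<open>
  A form of degree \<open>k\<close> takes a point and a list of \<open>k\<close> tangent vectors at this point. It is
  required to be \<open>0\<close> on all other arguments, so that equality of forms is equality of functions.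
\<close>

type_synonym ('a, 'e) form = "'a \<Rightarrow> ('a, 'e) tvec list \<Rightarrow> real"

definition tangent_tuples ::
  "('a, 'e::real_normed_vector) manifold \<Rightarrow> nat \<Rightarrow> 'a \<Rightarrow> ('a, 'e) tvec list set" where
  "tangent_tuples M k p = {vs. length vs = k \<and> set vs \<subseteq> tangent_space M p}"

locale differential_form =
  fixes M :: "('a, 'e::real_normed_vector) manifold" and k :: nat and \<omega> :: "('a, 'e) form"
  assumes support: "p \<notin> topspace (mtop M) \<or> vs \<notin> tangent_tuples M k p \<Longrightarrow> \<omega> p vs = 0"
    and multilinear: "\<lbrakk>p \<in> topspace (mtop M); vs \<in> tangent_tuples M k p; i < k;
      v \<in> tangent_space M p; w \<in> tangent_space M p\<rbrakk> \<Longrightarrow>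
      \<omega> p (vs[i := (\<lambda>c. a *\<^sub>R v c + b *\<^sub>R w c)]) = a * \<omega> p (vs[i := v]) + b * \<omega> p (vs[i := w])"
    and alternating: "\<lbrakk>p \<in> topspace (mtop M); vs \<in> tangent_tuples M k p; i < j; j < k;
      vs ! i = vs ! j\<rbrakk> \<Longrightarrow> \<omega> p vs = 0"
    and smooth: "\<lbrakk>c \<in> atlas M; length us = k\<rbrakk> \<Longrightarrow>
      smooth_on (snd c ` fst c)
        (\<lambda>x. let p = inv_into (fst c) (snd c) x in \<omega> p (map (coord_vec M p c) us))"

definition pullback ::
  "('a, 'e::real_normed_vector) manifold \<Rightarrow> ('b, 'f::real_normed_vector) manifold \<Rightarrow> ('a \<Rightarrow> 'b)
     \<Rightarrow> ('b, 'f) form \<Rightarrow> ('a, 'e) form" where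
  "pullback M N f \<omega> = (\<lambda>p vs. if p \<in> topspace (mtop M) \<and> set vs \<subseteq> tangent_space M p
     then \<omega> (f p) (map (differential M N f p) vs) else 0)"


section \<open>Lie groups and primitive forms\<close>

locale lie_group = group G + smooth_manifold M
  for G :: "('a, 'b) monoid_scheme" (structure)
    and M :: "('a, 'e::real_normed_vector) manifold" +
  assumes carrier_eq: "topspace (mtop M) = carrier G"
    and smooth_mult: "smooth_map (prod_manifold M M) M (\<lambda>(x, y). x \<otimes> y)"
    and smooth_inv: "smooth_map M M (\<lambda>x. inv x)"

definition primitive ::
  "('a, 'b) monoid_scheme \<Rightarrow> ('a, 'e::real_normed_vector) manifold \<Rightarrow> ('a, 'e) form \<Rightarrow> bool" where
  "primitive G M \<eta> \<longleftrightarrow>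
     pullback (prod_manifold M M) M (\<lambda>(x, y). x \<otimes>\<^bsub>G\<^esub> y) \<eta> =
     (\<lambda>p vs. pullback (prod_manifold M M) M fst \<eta> p vs + pullback (prod_manifold M M) M snd \<eta> p vs)"

definition primitive_forms ::
  "('a, 'b) monoid_scheme \<Rightarrow> ('a, 'e::real_normed_vector) manifold \<Rightarrow> nat \<Rightarrow> ('a, 'e) form set" where
  "primitive_forms G M k = {\<eta>. differential_form M k \<eta> \<and> primitive G M \<eta>}"

end

theory Submission
  imports Defs
begin

text \<open>
  A sum of pullbacks along the two projections has no mixed terms, while the multiplication mixes the
  two factors in every direction. Precisely, evaluate the equation for a primitive 2-form \<open>\<eta>\<close> at the
  point \<open>(x, \<one>)\<close> on a pair of tangent vectors of the form \<open>(v, 0)\<close>, \<open>(0, w')\<close>. The right-hand side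
  is \<open>\<eta>\<^sub>x(v, 0) + \<eta>\<^sub>\<one>(0, w') = 0\<close> by multilinearity. The left-hand side is \<open>\<eta>\<^sub>x\<close> evaluated on the
  images of the two vectors under the differential of the multiplication. This differential sends
  \<open>(v, 0)\<close> to \<open>v\<close> (\<open>differential_mult_tvec_pair_left\<close>), and it sends \<open>(0, w')\<close> to an arbitrary given
  vector \<open>w\<close> if \<open>w'\<close> is chosen suitably (\<open>differential_mult_tvec_pair_right\<close>), since left
  translations are diffeomorphisms. Hence \<open>\<eta>\<^sub>x(v, w) = 0\<close> for all \<open>v\<close> and \<open>w\<close> at all \<open>x\<close>.

  Both statements on the differential are instances of one chain rule, \<open>loc_rep_mult_section\<close>: the maps
  \<open>z \<mapsto> (z, \<one>)\<close> and \<open>z \<mapsto> (x, inv x \<otimes> z)\<close> are sections of the multiplication, both through the point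
  \<open>(x, \<one>)\<close>, so the differential of the multiplication is a left inverse of each of their differentials.
\<close>

section \<open>Charts and tangent vectors\<close>

lemma smooth_on_imp_differentiable:
  assumes "smooth_on S f" "x \<in> S"
  shows "f differentiable (at x)"
  using assms Ck_on.simps(2)[of 0 S f] unfolding smooth_on_def by blast

lemma Ck_on_zero: "Ck_on k S (\<lambda>x. 0)"
  by (induction k) (auto simp: frechet_derivative_const)

lemma smooth_on_zero: "smooth_on S (\<lambda>x. 0)"
  by (simp add: smooth_on_def Ck_on_zero)

lemma tangent_space_transition:
  assumes "v \<in> tangent_space M p" "c \<in> charts_at M p" "d \<in> charts_at M p"
  shows "frechet_derivative (loc_rep c id d) (at (snd c p)) (v c) = v d"
proof (rule sym)
  show "v d = frechet_derivative (loc_rep c id d) (at (snd c p)) (v c)"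
    using assms unfolding tangent_space_def by blast
qed

lemma tangent_space_outside:
  "v \<in> tangent_space M p \<Longrightarrow> c \<notin> charts_at M p \<Longrightarrow> v c = 0"
  unfolding tangent_space_def by blast

context smooth_manifold
begin

lemma chart_inj_on: "c \<in> atlas M \<Longrightarrow> inj_on (snd c) (fst c)"
  using charts[of c]
  by (auto simp: is_chart_def Int_absorb1[OF openin_subset]
      dest!: homeomorphic_imp_injective_map split: prod.splits)

lemma chart_domain_open: "c \<in> atlas M \<Longrightarrow> openin (mtop M) (fst c)"
  using charts[of c] by (auto simp: is_chart_def)

lemma chart_image_open:
  assumes "c \<in> atlas M" "openin (mtop M) W" "W \<subseteq> fst c"
  shows "open (snd c ` W)"
proof -
  have "open (snd c ` fst c)"
    and h: "homeomorphic_map (subtopology (mtop M) (fst c)) (top_of_set (snd c ` fst c)) (snd c)"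
    using charts[OF assms(1)] by (auto simp: is_chart_def split: prod.splits)
  moreover have "openin (subtopology (mtop M) (fst c)) W"
    using assms by (metis inf.absorb1 openin_subtopology)
  ultimately show ?thesis
    using homeomorphic_imp_open_map[OF h] open_map_def openin_open_eq by metis
qed

lemma charts_at_nonempty:
  assumes "p \<in> topspace (mtop M)"
  obtains c where "c \<in> charts_at M p"
  using assms covering unfolding charts_at_def by blast

lemma charts_at_point: "c \<in> charts_at M p \<Longrightarrow> p \<in> topspace (mtop M)"
  using chart_domain_open openin_subset unfolding charts_at_def by blast

lemma transition_has_derivative:
  assumes "c \<in> charts_at M p" "d \<in> charts_at M p"
  shows "(loc_rep c id d has_derivative
    frechet_derivative (loc_rep c id d) (at (snd c p))) (at (snd c p))"
proof -
  have "loc_rep c id d differentiable (at (snd c p))"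
    using assms compatible[of c d]
    by (intro smooth_on_imp_differentiable[of "snd c ` (fst c \<inter> fst d)"]) (auto simp: charts_at_def)
  then show ?thesis
    by (simp add: frechet_derivative_works)
qed

lemma transition_refl_derivative:
  assumes "c \<in> charts_at M p"
  shows "frechet_derivative (loc_rep c id c) (at (snd c p)) = (\<lambda>u. u)"
proof -
  have c: "c \<in> atlas M" "p \<in> fst c"
    using assms by (auto simp: charts_at_def)
  have "(loc_rep c id c has_derivative (\<lambda>u. u)) (at (snd c p))"
    by (rule has_derivative_transform_within_open[OF has_derivative_ident, of "snd c ` fst c"])
       (use c chart_image_open chart_domain_open in \<open>auto simp: loc_rep_def f_inv_into_f\<close>)
  then show ?thesis
    by (metis frechet_derivative_at)
qed

lemma zero_in_tangent_space: "(\<lambda>c. 0) \<in> tangent_space M p"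
proof -
  have "frechet_derivative (loc_rep c id d) (at (snd c p)) 0 = 0"
    if "c \<in> charts_at M p" "d \<in> charts_at M p" for c d
    using linear_0[OF has_derivative_linear[OF transition_has_derivative[OF that]]] .
  then show ?thesis
    by (simp add: tangent_space_def)
qed

lemma coord_vec_same:
  "c \<in> charts_at M p \<Longrightarrow> coord_vec M p c u c = u"
  by (simp add: coord_vec_def transition_refl_derivative)

text \<open>
  By the chain rule for the transition maps, the coordinates that \<open>coord_vec\<close> computes from the single
  chart \<open>c\<close> are compatible for any two further charts.
\<close>

lemma coord_vec_in_tangent_space:
  assumes c: "c \<in> charts_at M p"
  shows "coord_vec M p c u \<in> tangent_space M p"
proof -
  let ?D = "\<lambda>c d. frechet_derivative (loc_rep c id d) (at (snd c p))"
  have chain: "?D c e u = ?D d e (?D c d u)" if de: "d \<in> charts_at M p" "e \<in> charts_at M p" for d e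
  proof -
    have at: "c \<in> atlas M" "p \<in> fst c" "d \<in> atlas M" "p \<in> fst d"
      using c de by (auto simp: charts_at_def)
    note inj = chart_inj_on[OF at(1)] chart_inj_on[OF at(3)]
    have p: "loc_rep c id d (snd c p) = snd d p"
      using at inj by (simp add: loc_rep_def)
    have "(loc_rep c id e has_derivative (\<lambda>h. ?D d e (?D c d h))) (at (snd c p))"
    proof (rule has_derivative_transform_within_open)
      show "((\<lambda>a. loc_rep d id e (loc_rep c id d a)) has_derivative (\<lambda>h. ?D d e (?D c d h)))
          (at (snd c p))"
        using has_derivative_compose[OF transition_has_derivative[OF c de(1)],
            of "loc_rep d id e" "?D d e"] transition_has_derivative[OF de] p
        by simp
      show "open (snd c ` (fst c \<inter> fst d))"
        using at chart_image_open chart_domain_open by blast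
    qed (use at inj in \<open>auto simp: loc_rep_def\<close>)
    then show ?thesis
      by (metis frechet_derivative_at)
  qed
  show ?thesis
    by (auto simp: tangent_space_def coord_vec_def intro: chain)
qed

end

section \<open>Tangent vectors of a product\<close>

definition prod_chart :: "('a, 'e) chart \<Rightarrow> ('b, 'f) chart \<Rightarrow> ('a \<times> 'b, 'e \<times> 'f) chart" where
  "prod_chart c d = (fst c \<times> fst d, map_prod (snd c) (snd d))"

lemma charts_at_prod_iff:
  "C \<in> charts_at (prod_manifold M N) (x, y) \<longleftrightarrow>
    (\<exists>c d. C = prod_chart c d \<and> c \<in> charts_at M x \<and> d \<in> charts_at N y)"
proof
  assume "C \<in> charts_at (prod_manifold M N) (x, y)"
  then obtain U \<phi> V \<psi> where "C = (U \<times> V, map_prod \<phi> \<psi>)"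
    and "(U, \<phi>) \<in> atlas M" "(V, \<psi>) \<in> atlas N" "x \<in> U" "y \<in> V"
    by (auto simp: charts_at_def prod_manifold_def)
  then show "\<exists>c d. C = prod_chart c d \<and> c \<in> charts_at M x \<and> d \<in> charts_at N y"
    by (intro exI[of _ "(U, \<phi>)"] exI[of _ "(V, \<psi>)"]) (simp add: charts_at_def prod_chart_def)
qed (auto simp: charts_at_def prod_manifold_def prod_chart_def)

lemma prod_chart_in_charts_at:
  "c \<in> charts_at M x \<Longrightarrow> d \<in> charts_at N y \<Longrightarrow> prod_chart c d \<in> charts_at (prod_manifold M N) (x, y)"
  unfolding charts_at_prod_iff by (rule exI[of _ c], rule exI[of _ d]) simp

text \<open>
  A product chart determines its two factors as soon as its domain is nonempty, so the pair of
  tangent vectors can be defined by reading the factors off. The coordinate map acts on the two factors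
  separately, so any value can stand in for the other argument; \<open>undefined\<close> is used.
\<close>

definition tvec_pair ::
  "('a, 'e::real_normed_vector) manifold \<Rightarrow> ('b, 'f::real_normed_vector) manifold \<Rightarrow> 'a \<times> 'b
     \<Rightarrow> ('a, 'e) tvec \<Rightarrow> ('b, 'f) tvec \<Rightarrow> ('a \<times> 'b, 'e \<times> 'f) tvec" where
  "tvec_pair M N p v w C = (if C \<in> charts_at (prod_manifold M N) p
     then (v (fst ` fst C, \<lambda>a. fst (snd C (a, undefined))),
           w (snd ` fst C, \<lambda>b. snd (snd C (undefined, b))))
     else 0)"

lemma tvec_pair_prod_chart:
  assumes "c \<in> charts_at M x" "d \<in> charts_at N y"
  shows "tvec_pair M N (x, y) v w (prod_chart c d) = (v c, w d)"
proof -
  have "fst ` (fst c \<times> fst d) = fst c" "snd ` (fst c \<times> fst d) = fst d"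
    using assms by (auto simp: charts_at_def)
  moreover have "prod_chart c d \<in> charts_at (prod_manifold M N) (x, y)"
    using assms by (rule prod_chart_in_charts_at)
  ultimately show ?thesis
    by (simp add: tvec_pair_def prod_chart_def)
qed

lemma loc_rep_prod_chart:
  assumes "inj_on (snd c) (fst c)" "inj_on (snd d) (fst d)"
    and "a \<in> snd c ` fst c" "b \<in> snd d ` fst d"
  shows "loc_rep (prod_chart c d) f e (a, b) =
    snd e (f (inv_into (fst c) (snd c) a, inv_into (fst d) (snd d) b))"
proof -
  have "inj_on (map_prod (snd c) (snd d)) (fst c \<times> fst d)"
    using assms by (simp add: map_prod_inj_on)
  then have "inv_into (fst c \<times> fst d) (map_prod (snd c) (snd d)) (a, b) =
      (inv_into (fst c) (snd c) a, inv_into (fst d) (snd d) b)"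
    by (rule inv_into_f_eq) (use assms in \<open>auto simp: inv_into_into f_inv_into_f\<close>)
  then show ?thesis
    by (simp add: loc_rep_def prod_chart_def)
qed

locale two_manifolds = M: smooth_manifold M + N: smooth_manifold N
  for M :: "('a, 'e::real_normed_vector) manifold"
    and N :: "('b, 'f::real_normed_vector) manifold"
begin

lemma loc_rep_prod_charts_at:
  assumes "c \<in> charts_at M x" "d \<in> charts_at N y"
    and "a \<in> snd c ` fst c" "b \<in> snd d ` fst d"
  shows "loc_rep (prod_chart c d) f e (a, b) =
    snd e (f (inv_into (fst c) (snd c) a, inv_into (fst d) (snd d) b))"
  using assms M.chart_inj_on N.chart_inj_on
  by (intro loc_rep_prod_chart) (auto simp: charts_at_def)

lemma prod_chart_image_open:
  assumes "c \<in> charts_at M x" "d \<in> charts_at N y"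
  shows "open (snd c ` fst c \<times> snd d ` fst d)"
  using assms M.chart_image_open N.chart_image_open M.chart_domain_open N.chart_domain_open
  by (intro open_Times) (auto simp: charts_at_def)

lemma prod_chart_point:
  assumes "c \<in> charts_at M x" "d \<in> charts_at N y"
  shows "snd (prod_chart c d) (x, y) = (snd c x, snd d y)"
    and "(snd c x, snd d y) \<in> snd c ` fst c \<times> snd d ` fst d"
  using assms by (auto simp: prod_chart_def charts_at_def)

lemma loc_rep_fst_has_derivative:
  assumes "c1 \<in> charts_at M x" "c2 \<in> charts_at N y" "d \<in> charts_at M x"
  shows "(loc_rep (prod_chart c1 c2) fst d has_derivative
    (\<lambda>h. frechet_derivative (loc_rep c1 id d) (at (snd c1 x)) (fst h)))
    (at (snd c1 x, snd c2 y))"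
proof (rule has_derivative_transform_within_open)
  show "((\<lambda>z. loc_rep c1 id d (fst z)) has_derivative
    (\<lambda>h. frechet_derivative (loc_rep c1 id d) (at (snd c1 x)) (fst h))) (at (snd c1 x, snd c2 y))"
    by (rule has_derivative_compose[OF has_derivative_fst[OF has_derivative_ident]])
       (use M.transition_has_derivative[OF assms(1,3)] in \<open>simp add: id_def\<close>)
  show "loc_rep c1 id d (fst z) = loc_rep (prod_chart c1 c2) fst d z"
    if "z \<in> snd c1 ` fst c1 \<times> snd c2 ` fst c2" for z
    using that assms loc_rep_prod_charts_at[of c1 x c2 y "fst z" "snd z" fst d]
    by (auto simp: loc_rep_def)
qed (use assms prod_chart_image_open prod_chart_point in auto)

lemma loc_rep_snd_has_derivative:
  assumes "c1 \<in> charts_at M x" "c2 \<in> charts_at N y" "d \<in> charts_at N y"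
  shows "(loc_rep (prod_chart c1 c2) snd d has_derivative
    (\<lambda>h. frechet_derivative (loc_rep c2 id d) (at (snd c2 y)) (snd h)))
    (at (snd c1 x, snd c2 y))"
proof (rule has_derivative_transform_within_open)
  show "((\<lambda>z. loc_rep c2 id d (snd z)) has_derivative
    (\<lambda>h. frechet_derivative (loc_rep c2 id d) (at (snd c2 y)) (snd h))) (at (snd c1 x, snd c2 y))"
    by (rule has_derivative_compose[OF has_derivative_snd[OF has_derivative_ident]])
       (use N.transition_has_derivative[OF assms(2,3)] in \<open>simp add: id_def\<close>)
  show "loc_rep c2 id d (snd z) = loc_rep (prod_chart c1 c2) snd d z"
    if "z \<in> snd c1 ` fst c1 \<times> snd c2 ` fst c2" for z
    using that assms loc_rep_prod_charts_at[of c1 x c2 y "fst z" "snd z" snd d]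
    by (auto simp: loc_rep_def)
qed (use assms prod_chart_image_open prod_chart_point in auto)

text \<open>
  The transition map between two product charts is, coordinatewise, the two projections expressed in
  these charts. So its derivative is the pair of the derivatives of the transition maps of the factors.
\<close>

lemma tvec_pair_in_tangent_space:
  assumes v: "v \<in> tangent_space M x" and w: "w \<in> tangent_space N y"
  shows "tvec_pair M N (x, y) v w \<in> tangent_space (prod_manifold M N) (x, y)"
proof -
  have "tvec_pair M N (x, y) v w D =
      frechet_derivative (loc_rep C id D) (at (snd C (x, y))) (tvec_pair M N (x, y) v w C)"
    if CD: "C \<in> charts_at (prod_manifold M N) (x, y)" "D \<in> charts_at (prod_manifold M N) (x, y)"
    for C D
  proof -
    obtain c1 c2 d1 d2 where C: "C = prod_chart c1 c2" and c: "c1 \<in> charts_at M x" "c2 \<in> charts_at N y"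
      and D: "D = prod_chart d1 d2" and d: "d1 \<in> charts_at M x" "d2 \<in> charts_at N y"
      using CD unfolding charts_at_prod_iff by blast
    have "loc_rep C id D = (\<lambda>z. (loc_rep C fst d1 z, loc_rep C snd d2 z))"
      by (auto simp: loc_rep_def D prod_chart_def fun_eq_iff map_prod_def split: prod.splits)
    then have "(loc_rep C id D has_derivative
       (\<lambda>h. (frechet_derivative (loc_rep c1 id d1) (at (snd c1 x)) (fst h),
             frechet_derivative (loc_rep c2 id d2) (at (snd c2 y)) (snd h)))) (at (snd C (x, y)))"
      unfolding C prod_chart_point[OF c]
      using has_derivative_Pair[OF loc_rep_fst_has_derivative[OF c d(1)]
          loc_rep_snd_has_derivative[OF c d(2)]] by simp
    from frechet_derivative_at[OF this, symmetric] show ?thesis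
      using c d by (simp add: C D tvec_pair_prod_chart tangent_space_transition[OF v]
          tangent_space_transition[OF w])
  qed
  moreover have "tvec_pair M N (x, y) v w C = 0" if "C \<notin> charts_at (prod_manifold M N) (x, y)" for C
    using that by (simp add: tvec_pair_def)
  ultimately show ?thesis
    unfolding tangent_space_def by blast
qed

text \<open>
  The differential is computed in an unspecified chart, which near a point of a product is a product
  chart; this reduces each computation of a differential below to a product chart.
\<close>

lemma chosen_prod_chart:
  assumes "x \<in> topspace (mtop M)" "y \<in> topspace (mtop N)"
  obtains c d where "(SOME C. C \<in> charts_at (prod_manifold M N) (x, y)) = prod_chart c d"
    and "c \<in> charts_at M x" "d \<in> charts_at N y"
proof -
  have "\<exists>C. C \<in> charts_at (prod_manifold M N) (x, y)"
    using assms M.charts_at_nonempty N.charts_at_nonempty prod_chart_in_charts_at by metis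
  then have "(SOME C. C \<in> charts_at (prod_manifold M N) (x, y)) \<in> charts_at (prod_manifold M N) (x, y)"
    by (rule someI_ex)
  then show thesis
    using that unfolding charts_at_prod_iff by blast
qed

lemma differential_fst_tvec_pair:
  assumes "x \<in> topspace (mtop M)" "y \<in> topspace (mtop N)" and v: "v \<in> tangent_space M x"
  shows "differential (prod_manifold M N) M fst (x, y) (tvec_pair M N (x, y) v w) = v"
proof -
  obtain c1 c2 where C: "(SOME C. C \<in> charts_at (prod_manifold M N) (x, y)) = prod_chart c1 c2"
    and c: "c1 \<in> charts_at M x" "c2 \<in> charts_at N y"
    using chosen_prod_chart[OF assms(1,2)] by blast
  show ?thesis
  proof
    fix d
    show "differential (prod_manifold M N) M fst (x, y) (tvec_pair M N (x, y) v w) d = v d"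
    proof (cases "d \<in> charts_at M x")
      case True
      from frechet_derivative_at[OF loc_rep_fst_has_derivative[OF c True], symmetric] show ?thesis
        using c True by (simp add: differential_def C tvec_pair_prod_chart prod_chart_point
            tangent_space_transition[OF v])
    qed (simp add: differential_def tangent_space_outside[OF v])
  qed
qed

lemma differential_snd_tvec_pair:
  assumes "x \<in> topspace (mtop M)" "y \<in> topspace (mtop N)" and w: "w \<in> tangent_space N y"
  shows "differential (prod_manifold M N) N snd (x, y) (tvec_pair M N (x, y) v w) = w"
proof -
  obtain c1 c2 where C: "(SOME C. C \<in> charts_at (prod_manifold M N) (x, y)) = prod_chart c1 c2"
    and c: "c1 \<in> charts_at M x" "c2 \<in> charts_at N y"
    using chosen_prod_chart[OF assms(1,2)] by blast
  show ?thesis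
  proof
    fix d
    show "differential (prod_manifold M N) N snd (x, y) (tvec_pair M N (x, y) v w) d = w d"
    proof (cases "d \<in> charts_at N y")
      case True
      from frechet_derivative_at[OF loc_rep_snd_has_derivative[OF c True], symmetric] show ?thesis
        using c True by (simp add: differential_def C tvec_pair_prod_chart prod_chart_point
            tangent_space_transition[OF w])
    qed (simp add: differential_def tangent_space_outside[OF w])
  qed
qed

end

section \<open>The differential of the multiplication at the points \<open>(x, \<one>)\<close>\<close>

context lie_group
begin

sublocale two_manifolds M M ..

abbreviation mult :: "'a \<times> 'a \<Rightarrow> 'a" where
  "mult \<equiv> (\<lambda>(x, y). x \<otimes> y)"

lemma loc_rep_mult_differentiable:
  assumes "c1 \<in> charts_at M x" "c2 \<in> charts_at M y" "d \<in> charts_at M (x \<otimes> y)"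
  shows "loc_rep (prod_chart c1 c2) mult d differentiable (at (snd c1 x, snd c2 y))"
proof (rule smooth_on_imp_differentiable)
  have "prod_chart c1 c2 \<in> atlas (prod_manifold M M)" "d \<in> atlas M"
    using prod_chart_in_charts_at[OF assms(1,2)] assms(3) by (auto simp: charts_at_def)
  then show "smooth_on (snd (prod_chart c1 c2) ` (fst (prod_chart c1 c2) \<inter> mult -` fst d))
      (loc_rep (prod_chart c1 c2) mult d)"
    using smooth_mult unfolding smooth_map_def by blast
  show "(snd c1 x, snd c2 y) \<in> snd (prod_chart c1 c2) ` (fst (prod_chart c1 c2) \<inter> mult -` fst d)"
    using assms by (intro image_eqI[of _ _ "(x, y)"]) (auto simp: prod_chart_def charts_at_def)
qed

lemma continuous_left_mult:
  assumes "x \<in> carrier G"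
  shows "continuous_map (mtop M) (mtop M) (\<lambda>z. x \<otimes> z)"
proof -
  have "continuous_map (mtop M) (prod_topology (mtop M) (mtop M)) (\<lambda>z. (x, z))"
    using assms by (intro continuous_map_pairedI) (auto simp: carrier_eq)
  moreover have "continuous_map (prod_topology (mtop M) (mtop M)) (mtop M) mult"
    using smooth_mult by (simp add: smooth_map_def prod_manifold_def)
  ultimately show ?thesis
    using continuous_map_compose by (fastforce simp: o_def)
qed

text \<open>
  A map \<open>\<sigma>\<close> with \<open>mult \<circ> \<sigma> = id\<close> near \<open>x\<close> and \<open>\<sigma> x = (x, \<one>)\<close> satisfies
  \<open>d mult \<circ> d\<sigma> = id\<close> by the chain rule. Here \<open>s\<close> is such a section in coordinates, and \<open>s'\<close> its
  derivative, so the vector with coordinates \<open>s' (v c)\<close> is \<open>d\<sigma> v\<close>.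
\<close>

lemma loc_rep_mult_section:
  assumes c: "c \<in> charts_at M x" and c': "c' \<in> charts_at M \<one>" and d: "d \<in> charts_at M x"
    and v: "v \<in> tangent_space M x"
    and s: "(s has_derivative s') (at (snd c x))" "s (snd c x) = (snd c x, snd c' \<one>)"
    and S: "open S" "snd c x \<in> S"
    and sec: "\<And>a. a \<in> S \<Longrightarrow> loc_rep (prod_chart c c') mult d (s a) = loc_rep c id d a"
  shows "frechet_derivative (loc_rep (prod_chart c c') mult d) (at (snd c x, snd c' \<one>)) (s' (v c)) = v d"
proof -
  let ?F = "loc_rep (prod_chart c c') mult d"
  have "x \<in> carrier G"
    using charts_at_point[OF c] carrier_eq by simp
  then have "(?F has_derivative frechet_derivative ?F (at (s (snd c x)))) (at (s (snd c x)))"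
    using loc_rep_mult_differentiable[OF c c', of d] d s(2) by (simp add: frechet_derivative_works)
  from has_derivative_compose[OF s(1) this]
  have "(loc_rep c id d has_derivative (\<lambda>h. frechet_derivative ?F (at (s (snd c x))) (s' h)))
      (at (snd c x))"
    by (rule has_derivative_transform_within_open[OF _ S]) (rule sec)
  then have "frechet_derivative (loc_rep c id d) (at (snd c x)) (v c) =
      frechet_derivative ?F (at (snd c x, snd c' \<one>)) (s' (v c))"
    using s(2) by (metis frechet_derivative_at)
  then show ?thesis
    by (simp add: tangent_space_transition[OF v c d])
qed

text \<open>The section \<open>z \<mapsto> (z, \<one>)\<close> of the multiplication.\<close>

lemma differential_mult_tvec_pair_left:
  assumes v: "v \<in> tangent_space M x" and x: "x \<in> carrier G"
  shows "differential (prod_manifold M M) M mult (x, \<one>) (tvec_pair M M (x, \<one>) v (\<lambda>c. 0)) = v"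
proof -
  obtain c c' where C: "(SOME C. C \<in> charts_at (prod_manifold M M) (x, \<one>)) = prod_chart c c'"
    and c: "c \<in> charts_at M x" and c': "c' \<in> charts_at M \<one>"
    using chosen_prod_chart[of x \<one>] x one_closed unfolding carrier_eq by blast
  have at: "c \<in> atlas M" "x \<in> fst c" "c' \<in> atlas M" "\<one> \<in> fst c'"
    using c c' by (auto simp: charts_at_def)
  have "frechet_derivative (loc_rep (prod_chart c c') mult d) (at (snd c x, snd c' \<one>)) (v c, 0) = v d"
    if d: "d \<in> charts_at M x" for d
  proof (rule loc_rep_mult_section[OF c c' d v, where s = "\<lambda>a. (a, snd c' \<one>)" and s' = "\<lambda>h. (h, 0)"])
    show "((\<lambda>a. (a, snd c' \<one>)) has_derivative (\<lambda>h. (h, 0))) (at (snd c x))"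
      by (intro has_derivative_Pair has_derivative_ident has_derivative_const)
    show "open (snd c ` fst c)"
      using at chart_image_open chart_domain_open by blast
    show "loc_rep (prod_chart c c') mult d (a, snd c' \<one>) = loc_rep c id d a"
      if "a \<in> snd c ` fst c" for a
    proof -
      have "inv_into (fst c) (snd c) a \<in> carrier G"
        using that at inv_into_into[OF that] chart_domain_open[of c] openin_subset carrier_eq by blast
      then show ?thesis
        using that at chart_inj_on
        by (subst loc_rep_prod_charts_at[OF c c']) (auto simp: loc_rep_def)
    qed
  qed (use at in auto)
  then show ?thesis
    using c c' x by (auto simp: differential_def C tvec_pair_prod_chart prod_chart_point
        tangent_space_outside[OF v] fun_eq_iff)
qed

text \<open>
  The section \<open>z \<mapsto> (x, inv x \<otimes> z)\<close> of the multiplication; the vector \<open>w'\<close> is the image of \<open>w\<close>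
  under the differential of the left translation by \<open>inv x\<close>.
\<close>

lemma differential_mult_tvec_pair_right:
  assumes w: "w \<in> tangent_space M x" and x: "x \<in> carrier G"
  obtains w' where "w' \<in> tangent_space M \<one>"
    and "differential (prod_manifold M M) M mult (x, \<one>) (tvec_pair M M (x, \<one>) (\<lambda>c. 0) w') = w"
proof -
  obtain c c' where C: "(SOME C. C \<in> charts_at (prod_manifold M M) (x, \<one>)) = prod_chart c c'"
    and c: "c \<in> charts_at M x" and c': "c' \<in> charts_at M \<one>"
    using chosen_prod_chart[of x \<one>] x one_closed unfolding carrier_eq by blast
  have at: "c \<in> atlas M" "x \<in> fst c" "c' \<in> atlas M" "\<one> \<in> fst c'"
    using c c' by (auto simp: charts_at_def)
  obtain b where b: "b \<in> charts_at M (inv x)"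
    using charts_at_nonempty[of "inv x"] inv_closed[OF x] unfolding carrier_eq by blast
  then have bat: "b \<in> atlas M" "inv x \<in> fst b"
    by (auto simp: charts_at_def)
  \<comment> \<open>left translation by \<open>inv x\<close> in coordinates, as a slice of the multiplication at \<open>(inv x, x)\<close>\<close>
  define h where "h = (\<lambda>a. loc_rep (prod_chart b c) mult c' (snd b (inv x), a))"
  have h: "h a = snd c' (inv x \<otimes> inv_into (fst c) (snd c) a)" if "a \<in> snd c ` fst c" for a
    unfolding h_def using that bat chart_inj_on
    by (subst loc_rep_prod_charts_at[OF b c]) auto
  define h' where "h' = frechet_derivative h (at (snd c x))"
  have "h differentiable (at (snd c x))"
  proof -
    have "loc_rep (prod_chart b c) mult c' differentiable (at (snd b (inv x), snd c x))"
      using loc_rep_mult_differentiable[OF b c, of c'] c' x by simp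
    then obtain F' where F': "(loc_rep (prod_chart b c) mult c' has_derivative F') (at (snd b (inv x), snd c x))"
      by (auto simp: differentiable_def)
    have slice: "((\<lambda>a. (snd b (inv x), a)) has_derivative (\<lambda>h. (0, h))) (at (snd c x))"
      by (intro has_derivative_Pair has_derivative_ident has_derivative_const)
    show ?thesis
      using has_derivative_compose[OF slice F'] unfolding h_def differentiable_def by blast
  qed
  then have h': "(h has_derivative h') (at (snd c x))"
    by (simp add: h'_def frechet_derivative_works)
  \<comment> \<open>near \<open>x\<close>, the value of \<open>h\<close> lies in the image of \<open>c'\<close>, so that \<open>inv x \<otimes> z\<close> can be recovered from it\<close>
  define W where "W = fst c \<inter> {z \<in> topspace (mtop M). inv x \<otimes> z \<in> fst c'}"
  have W: "openin (mtop M) W"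
    unfolding W_def using at x continuous_left_mult[of "inv x"] chart_domain_open
    by (intro openin_Int openin_continuous_map_preimage[of _ "mtop M"]) auto
  have der: "frechet_derivative (loc_rep (prod_chart c c') mult d) (at (snd c x, snd c' \<one>))
      (0, h' (w c)) = w d"
    if d: "d \<in> charts_at M x" for d
  proof (rule loc_rep_mult_section[OF c c' d w, where s = "\<lambda>a. (snd c x, h a)" and s' = "\<lambda>k. (0, h' k)"])
    show "((\<lambda>a. (snd c x, h a)) has_derivative (\<lambda>k. (0, h' k))) (at (snd c x))"
      by (intro has_derivative_Pair h' has_derivative_const)
    show "(snd c x, h (snd c x)) = (snd c x, snd c' \<one>)"
      using at x chart_inj_on by (simp add: h)
    show "open (snd c ` W)"
      using at W by (intro chart_image_open) (auto simp: W_def)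
    show "snd c x \<in> snd c ` W"
      using at x by (auto simp: W_def carrier_eq)
    show "loc_rep (prod_chart c c') mult d (snd c x, h a) = loc_rep c id d a"
      if "a \<in> snd c ` W" for a
    proof -
      obtain z where z: "a = snd c z" "z \<in> fst c" "z \<in> carrier G" "inv x \<otimes> z \<in> fst c'"
        using \<open>a \<in> snd c ` W\<close> by (auto simp: W_def carrier_eq)
      have "h a = snd c' (inv x \<otimes> z)"
        using z at chart_inj_on by (simp add: h)
      moreover have "x \<otimes> (inv x \<otimes> z) = z"
        using x z by (simp add: m_assoc[symmetric])
      ultimately show ?thesis
        using z at chart_inj_on
        by (subst loc_rep_prod_charts_at[OF c c']) (auto simp: loc_rep_def)
    qed
  qed
  show thesis
  proof
    show "coord_vec M \<one> c' (h' (w c)) \<in> tangent_space M \<one>"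
      using c' by (rule coord_vec_in_tangent_space)
    show "differential (prod_manifold M M) M mult (x, \<one>)
        (tvec_pair M M (x, \<one>) (\<lambda>c. 0) (coord_vec M \<one> c' (h' (w c)))) = w"
      using c c' x der by (auto simp: differential_def C tvec_pair_prod_chart prod_chart_point
          tangent_space_outside[OF w] coord_vec_same fun_eq_iff)
  qed
qed

end

section \<open>Primitive forms\<close>

lemma (in differential_form) zero_argument:
  assumes "p \<in> topspace (mtop M)" "vs \<in> tangent_tuples M k p" "i < k" "vs ! i = (\<lambda>c. 0)"
  shows "\<omega> p vs = 0"
proof -
  have "(\<lambda>c. 0) \<in> tangent_space M p"
    using assms unfolding tangent_tuples_def by (metis (mono_tags) mem_Collect_eq nth_mem subsetD)
  from multilinear[OF assms(1-3) this this, of 0 0] show ?thesis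
    using assms(4) by (metis list_update_id add_0 mult_zero_left scaleR_zero_right)
qed

lemma zero_differential_form: "differential_form M k (\<lambda>p vs. 0)"
  by unfold_locales (auto simp: smooth_on_zero)

lemma (in lie_group) primitive_2_form_eq_0:
  assumes "differential_form M 2 \<eta>" and prim: "primitive G M \<eta>"
  shows "\<eta> p vs = 0"
proof (cases "p \<in> topspace (mtop M) \<and> vs \<in> tangent_tuples M 2 p")
  case False
  then show ?thesis
    using differential_form.support[OF assms(1)] by blast
next
  case True
  then obtain v w where vs: "vs = [v, w]" and v: "v \<in> tangent_space M p" and w: "w \<in> tangent_space M p"
    by (auto simp: tangent_tuples_def numeral_2_eq_2 length_Suc_conv)
  have p: "p \<in> carrier G" and top: "p \<in> topspace (mtop M)" "\<one> \<in> topspace (mtop M)"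
    using True carrier_eq by auto
  obtain w' where w': "w' \<in> tangent_space M \<one>"
    and dw': "differential (prod_manifold M M) M mult (p, \<one>) (tvec_pair M M (p, \<one>) (\<lambda>c. 0) w') = w"
    using differential_mult_tvec_pair_right[OF w p] by blast
  \<comment> \<open>the mixed pair \<open>(v, 0)\<close>, \<open>(0, w')\<close> of tangent vectors of the product at \<open>(p, \<one>)\<close>\<close>
  let ?us = "[tvec_pair M M (p, \<one>) v (\<lambda>c. 0), tvec_pair M M (p, \<one>) (\<lambda>c. 0) w']"
  have us: "set ?us \<subseteq> tangent_space (prod_manifold M M) (p, \<one>)"
    using v w' zero_in_tangent_space tvec_pair_in_tangent_space by simp
  have pt: "(p, \<one>) \<in> topspace (mtop (prod_manifold M M))"
    using top by (simp add: prod_manifold_def)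
  have "\<eta> p [v, w] = pullback (prod_manifold M M) M mult \<eta> (p, \<one>) ?us"
    using us pt p differential_mult_tvec_pair_left[OF v p] dw' by (simp add: pullback_def)
  also have "\<dots> = pullback (prod_manifold M M) M fst \<eta> (p, \<one>) ?us +
      pullback (prod_manifold M M) M snd \<eta> (p, \<one>) ?us"
    using prim unfolding primitive_def by metis
  also have "\<dots> = \<eta> p [v, \<lambda>c. 0] + \<eta> \<one> [\<lambda>c. 0, w']"
    using us pt v w' top zero_in_tangent_space
    by (simp add: pullback_def differential_fst_tvec_pair differential_snd_tvec_pair)
  also have "\<eta> p [v, \<lambda>c. 0] = 0"
    using v top zero_in_tangent_space
    by (intro differential_form.zero_argument[OF assms(1), of _ _ 1]) (auto simp: tangent_tuples_def)
  also have "\<eta> \<one> [\<lambda>c. 0, w'] = 0"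
    using w' top zero_in_tangent_space
    by (intro differential_form.zero_argument[OF assms(1), of _ _ 0]) (auto simp: tangent_tuples_def)
  finally show ?thesis
    by (simp add: vs)
qed

theorem corollary1p1:
  fixes G :: "('a, 'b) monoid_scheme"
    and M :: "('a, 'e::real_normed_vector) manifold"
  assumes "lie_group G M"
  shows "primitive_forms G M 2 = {\<lambda>p vs. 0}"
proof (intro equalityI subsetI)
  fix \<eta> assume "\<eta> \<in> primitive_forms G M 2"
  then have "\<eta> p vs = 0" for p vs
    using lie_group.primitive_2_form_eq_0[OF assms] by (simp add: primitive_forms_def)
  then show "\<eta> \<in> {\<lambda>p vs. 0}"
    by (simp add: fun_eq_iff)
next
  fix \<eta> :: "('a, 'e) form" assume "\<eta> \<in> {\<lambda>p vs. 0}"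
  then have "\<eta> = (\<lambda>p vs. 0)"
    by simp
  moreover have "primitive G M (\<lambda>p vs. 0)"
    by (simp add: primitive_def pullback_def)
  ultimately show "\<eta> \<in> primitive_forms G M 2"
    using zero_differential_form[of M 2] by (simp add: primitive_forms_def)
qed

end
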